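(* Let $a,b,u,v$ be non-negative integers. Then $$\sum_{c=0}^a\sum_{d=0}^b\alpha_q(a,b;c,d)\,\beta_q(c,d;u,v)=\delta_a^u\,\delta_b^v .$$ In particular, for any $P\in\mathbb{Z}[x,y]$, $$\alpha_q*(\beta_q*P)=P=\beta_q*(\alpha_q*P).$$
   Context: $q$ is a prime power (or $q=1$, in which case $q$-binomial coefficients are ordinary binomial coefficients). $\left[\begin{smallmatrix} n \\ k \end{smallmatrix}\right]_q$ denotes the $q$-binomial coefficient, equal to $0$ if $k>n$. $\delta_a^b$ is the Kronecker delta. For non-negative integers define $$\alpha_q(n,m;i,j):=\left[\begin{matrix} n \\ i \end{matrix}\right]_q\left[\begin{matrix} m \\ j \end{matrix}\right]_q q^{(n-i)(m-j)},$$ $$\beta_q(a,b;c,d):=(-1)^{(a-c)+(b-d)}\left[\begin{matrix} a \\ c \end{matrix}\right]_q\left[\begin{matrix} b \\ d \end{matrix}\right]_q q^{\binom{|(a-c)-(b-d)|}{2}}\bigl(1+q^{|(a-c)-(b-d)|}-q^{\max(a-c,\,b-d)}\bigr)$$ (so $\beta_q(a,b;c,d)=0$ if $c>a$ or $d>b$). For an integer-valued function $\gamma(i,j;a,b)$ of non-negative integers and $P(x,y)=\sum_{i=0}^{s}\sum_{j=0}^{t}p_{i,j}x^iy^j\in\mathbb{Z}[x,y]$, define $$\gamma*P:=\sum_{i=0}^{s}\sum_{j=0}^{t}p_{i,j}\sum_{a=0}^{i}\sum_{b=0}^{j}\gamma(i,j;a,b)\,x^ay^b .$$ *)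

theory Defs
  imports "HOL-Computational_Algebra.Polynomial" "HOL-Number_Theory.Prime_Powers"
begin

text \<open>
  The \<open>q\<close>-binomial coefficient is built from the \<open>q\<close>-integers \<open>1 + q + \<dots> + q^(n - 1)\<close>. For \<open>q > 1\<close>
  these equal \<open>(q^n - 1) / (q - 1)\<close>, and for \<open>q = 1\<close> they equal \<open>n\<close>, so that one formula
  covers both cases. The natural number division in \<open>q_binomial\<close> is exact, see
  \<open>q_binomial_mult_q_fact\<close> below.
\<close>

definition q_int :: "nat \<Rightarrow> nat \<Rightarrow> nat" where
  "q_int q n = (\<Sum>i<n. q ^ i)"

definition q_fact :: "nat \<Rightarrow> nat \<Rightarrow> nat" where
  "q_fact q n = (\<Prod>i=1..n. q_int q i)"

definition q_binomial :: "nat \<Rightarrow> nat \<Rightarrow> nat \<Rightarrow> nat" where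
  "q_binomial q n k =
     (if k \<le> n then q_fact q n div (q_fact q k * q_fact q (n - k)) else 0)"

lemma q_int_pos: "n > 0 \<Longrightarrow> q_int q n > 0"
  unfolding q_int_def by (rule sum_pos2[of _ 0]) auto

lemma q_fact_pos: "q_fact q n > 0"
  unfolding q_fact_def by (intro prod_pos) (auto intro: q_int_pos)

lemma q_fact_Suc: "q_fact q (Suc n) = q_int q (Suc n) * q_fact q n"
  by (simp add: q_fact_def mult.commute)

lemma q_int_add: "q_int q (k + m) = q_int q k + q ^ k * q_int q m"
  by (induction m) (simp_all add: q_int_def power_add algebra_simps)

lemma q_fact_mult_dvd: "q_fact q k * q_fact q m dvd q_fact q (k + m)"
proof (induction "k + m" arbitrary: k m rule: less_induct)
  case less
  show ?case
  proof (cases "k = 0 \<or> m = 0")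
    case True
    then show ?thesis by (auto simp: q_fact_def)
  next
    case False
    then obtain k' m' where km: "k = Suc k'" "m = Suc m'"
      by (metis not0_implies_Suc)
    have "q_fact q k' * q_fact q m dvd q_fact q (k' + m)"
      and "q_fact q k * q_fact q m' dvd q_fact q (k + m')"
      using km less[of k' m] less[of k m'] by simp_all
    then have "q_int q k * (q_fact q k' * q_fact q m) dvd q_int q k * q_fact q (k' + m)"
      and "q_int q m * (q_fact q k * q_fact q m') dvd q_int q m * q_fact q (k + m')"
      by (auto intro: mult_dvd_mono)
    then have "q_fact q k * q_fact q m dvd q_int q k * q_fact q (k' + m)"
      and "q_fact q k * q_fact q m dvd q_int q m * q_fact q (k + m')"
      by (simp_all add: km q_fact_Suc ac_simps)
    then have "q_fact q k * q_fact q m dvd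
        q_int q k * q_fact q (k' + m) + q ^ k * (q_int q m * q_fact q (k + m'))"
      by (rule dvd_add[OF _ dvd_mult])
    also have "\<dots> = q_int q (k + m) * q_fact q (k' + m)"
      unfolding q_int_add by (simp add: distrib_right mult.assoc km)
    also have "\<dots> = q_fact q (k + m)"
      by (simp add: km q_fact_Suc)
    finally show ?thesis .
  qed
qed

lemma q_binomial_mult_q_fact:
  assumes "k \<le> n"
  shows "q_binomial q n k * (q_fact q k * q_fact q (n - k)) = q_fact q n"
  using q_fact_mult_dvd[of q k "n - k"] assms by (simp add: q_binomial_def)

lemma q_binomial_1: "q_binomial 1 n k = n choose k"
proof -
  have "q_fact 1 j = fact j" for j
    by (simp add: q_fact_def q_int_def fact_prod)
  then show ?thesis
    by (auto simp: q_binomial_def binomial_fact' binomial_eq_0)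
qed

lemma q_int_geometric: "q > 0 \<Longrightarrow> (q - 1) * q_int q n = q ^ n - 1"
proof (induction n)
  case (Suc n)
  then have "q ^ n \<ge> 1" "q \<ge> 1" by simp_all
  with Suc show ?case
    by (simp add: q_int_def algebra_simps diff_mult_distrib)
qed (simp add: q_int_def)

definition \<alpha>_q :: "nat \<Rightarrow> nat \<Rightarrow> nat \<Rightarrow> nat \<Rightarrow> nat \<Rightarrow> int" where
  "\<alpha>_q q n m i j =
     int (q_binomial q n i) * int (q_binomial q m j) * int q ^ ((n - i) * (m - j))"

text \<open>
  If \<open>i > n\<close> or \<open>j > m\<close> (respectively \<open>c > a\<close> or \<open>d > b\<close>), some of the differences of natural numbers
  above and below are truncated, but then a \<open>q\<close>-binomial factor is \<open>0\<close>.
\<close>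

definition \<beta>_q :: "nat \<Rightarrow> nat \<Rightarrow> nat \<Rightarrow> nat \<Rightarrow> nat \<Rightarrow> int" where
  "\<beta>_q q a b c d =
     (let e = nat \<bar>int (a - c) - int (b - d)\<bar>
      in (- 1) ^ ((a - c) + (b - d)) * int (q_binomial q a c) * int (q_binomial q b d)
           * int q ^ (e choose 2) * (1 + int q ^ e - int q ^ max (a - c) (b - d)))"

text \<open>
  The ring \<open>\<int>[x, y]\<close> is represented by \<^typ>\<open>int poly poly\<close>, where the outer variable is \<open>x\<close> and the inner
  one is \<open>y\<close>: \<^term>\<open>xy_monom c i j\<close> is \<open>c x^i y^j\<close>, and \<^term>\<open>coeff (coeff P i) j\<close> is the coefficient of
  \<open>x^i y^j\<close> in \<open>P\<close>. In \<open>star\<close> the range of \<open>j\<close> depends on \<open>i\<close>, but any bounds \<open>s\<close> and \<open>t\<close> on the exponents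
  give the same polynomial, see \<open>star_sum_xy_monom\<close>.
\<close>

definition xy_monom :: "int \<Rightarrow> nat \<Rightarrow> nat \<Rightarrow> int poly poly" where
  "xy_monom c i j = monom (monom c j) i"

definition star :: "(nat \<Rightarrow> nat \<Rightarrow> nat \<Rightarrow> nat \<Rightarrow> int) \<Rightarrow> int poly poly \<Rightarrow> int poly poly"
    (infixr \<open>\<star>\<close> 75) where
  "\<gamma> \<star> P =
     (\<Sum>i\<le>degree P. \<Sum>j\<le>degree (coeff P i).
        smult [:coeff (coeff P i) j:] (\<Sum>a\<le>i. \<Sum>b\<le>j. xy_monom (\<gamma> i j a b) a b))"

lemma star_sum_xy_monom:
  assumes P: "P = (\<Sum>i\<le>s. \<Sum>j\<le>t. xy_monom (p i j) i j)"
  shows "\<gamma> \<star> P =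
     (\<Sum>i\<le>s. \<Sum>j\<le>t. smult [:p i j:] (\<Sum>a\<le>i. \<Sum>b\<le>j. xy_monom (\<gamma> i j a b) a b))"
proof -
  define F where "F i j = (\<Sum>a\<le>i. \<Sum>b\<le>j. xy_monom (\<gamma> i j a b) a b)" for i j
  have cf: "coeff P i = (if i \<le> s then (\<Sum>j\<le>t. monom (p i j) j) else 0)" for i
    by (simp add: P xy_monom_def coeff_sum monom_sum[symmetric] if_distrib sum.delta' cong: if_cong)
  have cf2: "coeff (coeff P i) j = (if i \<le> s \<and> j \<le> t then p i j else 0)" for i j
    by (simp add: cf coeff_sum)
  have deg: "degree P \<le> s" "degree (coeff P i) \<le> t" for i
    by (intro degree_le; simp add: poly_eq_iff cf2)+
  have "\<gamma> \<star> P = (\<Sum>i\<le>degree P. \<Sum>j\<le>t. smult [:coeff (coeff P i) j:] (F i j))"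
    unfolding star_def F_def[symmetric]
    by (intro sum.cong refl sum.mono_neutral_left) (auto simp: coeff_eq_0 deg)
  also have "\<dots> = (\<Sum>i\<le>s. \<Sum>j\<le>t. smult [:coeff (coeff P i) j:] (F i j))"
    by (intro sum.mono_neutral_left) (auto simp: coeff_eq_0 deg)
  also have "\<dots> = (\<Sum>i\<le>s. \<Sum>j\<le>t. smult [:p i j:] (F i j))"
    by (intro sum.cong refl) (simp add: cf2)
  finally show ?thesis by (simp add: F_def)
qed

end

theory Submission
  imports Defs Complex_Main
begin

text \<open>
  Trinomial revision \<open>[a, c] [c, u] = [a, u] [a - u, c - u]\<close> for \<open>q\<close>-binomial coefficients pulls a factor
  independent of the summation indices out of every entry of the matrix product \<open>\<alpha>\<beta>\<close>. Only differences
  of indices remain, so that the product is governed by a single kernel: with \<open>A = a - u\<close> and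
  \<open>B = b - v\<close>, all that is needed is
    \<open>(\<Sum>k\<le>A. \<Sum>l\<le>B. \<alpha>(A, B; k, l) \<beta>(k, l; 0, 0)) = [A = 0 \<and> B = 0]\<close>.
  By the symmetry \<open>[A, k] = [A, A - k]\<close>, the product \<open>\<beta>\<alpha>\<close> leads to the same double sum traversed
  backwards, so the kernel identity shows that \<open>\<beta>\<close> is an inverse on both sides.

  The key observation is that the absolute value and the maximum in \<open>\<beta>\<close> disappear once \<open>e choose 2\<close> is
  read as \<open>C e = e (e - 1) / 2\<close> for negative \<open>e\<close> as well. Up to the sign \<open>(-1)^(k + l)\<close>,
    \<open>\<beta>(k, l; 0, 0) = q^C(k - l) + q^C(l - k) - q^(C(k - l) + k)\<close>
  for all \<open>k\<close> and \<open>l\<close>, since \<open>C(-e) = C e + e\<close>. The mixed term \<open>- k l\<close> in \<open>C(k - l)\<close> cancels against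
  the one in the factor \<open>q^((A - k) (B - l))\<close> of \<open>\<alpha>\<close>. Hence each of the three double sums splits into a
  sum over \<open>k\<close> times a sum over \<open>l\<close>, and the \<open>q\<close>-binomial theorem turns both into products of factors
  \<open>1 - q^m\<close> with consecutive exponents. If \<open>A\<close> and \<open>B\<close> are positive, a factor with \<open>m = 0\<close> occurs in
  each of the three; otherwise the products are compared directly.

  On polynomials, \<open>\<star>\<close> multiplies the row vector of coefficients by the matrix, so the statement about
  \<open>\<star>\<close> is the fact that the two lower triangular matrices are mutually inverse.
\<close>

section \<open>Identities for \<open>q\<close>-binomial coefficients\<close>

lemma q_fact_0 [simp]: "q_fact q 0 = 1"
  by (simp add: q_fact_def)

lemma q_binomial_0_right [simp]: "q_binomial q n 0 = 1"
  using q_fact_pos[of q n] by (simp add: q_binomial_def)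

lemma q_binomial_self [simp]: "q_binomial q n n = 1"
  using q_fact_pos[of q n] by (simp add: q_binomial_def)

lemma q_binomial_eq_0 [simp]: "n < k \<Longrightarrow> q_binomial q n k = 0"
  by (simp add: q_binomial_def)

lemma q_binomial_symmetric: "k \<le> n \<Longrightarrow> q_binomial q n (n - k) = q_binomial q n k"
  by (simp add: q_binomial_def mult.commute)

text \<open>
  This is the splitting \<open>[n + 1] = [k + 1] + q^(k + 1) [n - k]\<close> of a \<open>q\<close>-integer, multiplied by \<open>[n]!\<close>
  and divided by the common denominator \<open>[k + 1]! [n - k]!\<close>.
\<close>

lemma q_binomial_Suc_Suc:
  "q_binomial q (Suc n) (Suc k) = q_binomial q n k + q ^ Suc k * q_binomial q n (Suc k)"
proof (cases "k < n")
  case True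
  then obtain m where n: "n = Suc (k + m)"
    using less_imp_Suc_add by blast
  define N where "N = q_fact q (Suc k) * q_fact q (Suc m)"
  have N: "N > 0"
    by (simp add: N_def q_fact_pos)
  have "q_binomial q n k * N = q_int q (Suc k) * q_fact q n"
    using q_binomial_mult_q_fact[of k n q] by (simp add: N_def n q_fact_Suc[of q k] algebra_simps)
  moreover have "q_binomial q n (Suc k) * N = q_int q (Suc m) * q_fact q n"
    using q_binomial_mult_q_fact[of "Suc k" n q]
    by (simp add: N_def n q_fact_Suc[of q m] algebra_simps)
  moreover have "q_binomial q (Suc n) (Suc k) * N = q_int q (Suc k + Suc m) * q_fact q n"
    using q_binomial_mult_q_fact[of "Suc k" "Suc n" q] by (simp add: N_def n q_fact_Suc[of q "Suc (k + m)"])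
  ultimately have "q_binomial q (Suc n) (Suc k) * N =
      (q_binomial q n k + q ^ Suc k * q_binomial q n (Suc k)) * N"
    unfolding q_int_add by (simp add: algebra_simps)
  with N show ?thesis by simp
qed (cases "k = n"; simp)

text \<open>
  After multiplication by \<open>[u]! [k]! [n - u - k]!\<close>, both sides become \<open>[n]!\<close>.
\<close>

lemma q_binomial_trinomial_revision:
  assumes "u \<le> n" "k \<le> n - u"
  shows "q_binomial q n (u + k) * q_binomial q (u + k) u = q_binomial q n u * q_binomial q (n - u) k"
proof -
  define N where "N = q_fact q u * q_fact q k * q_fact q (n - u - k)"
  have N: "N > 0"
    by (simp add: N_def q_fact_pos)
  have "q_binomial q n (u + k) * q_binomial q (u + k) u * N =
      q_binomial q n (u + k) * ((q_binomial q (u + k) u * (q_fact q u * q_fact q (u + k - u)))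
        * q_fact q (n - (u + k)))"
    by (simp add: N_def)
  also have "\<dots> = q_fact q n"
    using assms q_binomial_mult_q_fact[of u "u + k" q] q_binomial_mult_q_fact[of "u + k" n q]
    by (simp add: mult.assoc)
  also have "\<dots> = q_binomial q n u * (q_fact q u *
      (q_binomial q (n - u) k * (q_fact q k * q_fact q (n - u - k))))"
    unfolding q_binomial_mult_q_fact[OF assms(2)] q_binomial_mult_q_fact[OF assms(1)] ..
  finally show ?thesis
    using N by (simp add: N_def)
qed

text \<open>
  Write \<open>G n x\<close> for the sum. The Pascal rule splits \<open>G (n + 1) x\<close> into \<open>G n (q x)\<close> and
  \<open>- x G n (q x)\<close>, which accounts for the factor \<open>1 - x\<close> of the product.
\<close>

theorem q_binomial_theorem:
  fixes x :: "'a::comm_ring_1"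
  shows "(\<Sum>k\<le>n. of_nat (q_binomial q n k) * (- 1) ^ k * of_nat q ^ (k choose 2) * x ^ k)
           = (\<Prod>i<n. 1 - x * of_nat q ^ i)"
proof (induction n arbitrary: x)
  case (Suc n)
  define t where "t k = (- 1) ^ k * of_nat q ^ (k choose 2) * x ^ k" for k
  have t_Suc: "t (Suc k) = - x * of_nat q ^ k * t k" for k
    by (simp add: t_def numeral_2_eq_2 power_add algebra_simps)
  have IH: "(\<Sum>k\<le>n. of_nat (q_binomial q n k) * of_nat q ^ k * t k)
      = (\<Prod>i<n. 1 - x * of_nat q ^ Suc i)"
    using Suc[of "of_nat q * x"] by (simp add: t_def power_mult_distrib algebra_simps)
  have "(\<Sum>k\<le>Suc n. of_nat (q_binomial q (Suc n) k) * t k) =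
      t 0 + (\<Sum>k\<le>n. of_nat (q_binomial q n (Suc k)) * of_nat q ^ Suc k * t (Suc k))
          + (\<Sum>k\<le>n. of_nat (q_binomial q n k) * t (Suc k))"
    unfolding sum.atMost_Suc_shift
    by (simp add: q_binomial_Suc_Suc sum.distrib[symmetric] algebra_simps)
  also have "t 0 + (\<Sum>k\<le>n. of_nat (q_binomial q n (Suc k)) * of_nat q ^ Suc k * t (Suc k))
      = (\<Sum>k\<le>Suc n. of_nat (q_binomial q n k) * of_nat q ^ k * t k)"
    unfolding sum.atMost_Suc_shift by simp
  also have "\<dots> = (\<Prod>i<n. 1 - x * of_nat q ^ Suc i)"
    using IH by simp
  also have "(\<Sum>k\<le>n. of_nat (q_binomial q n k) * t (Suc k))
      = - x * (\<Sum>k\<le>n. of_nat (q_binomial q n k) * of_nat q ^ k * t k)"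
    by (simp add: t_Suc sum_distrib_left algebra_simps sum_negf)
  finally show ?case
    unfolding prod.lessThan_Suc_shift IH by (simp add: t_def algebra_simps)
qed (simp add: binomial_eq_0)

section \<open>The two-variable kernel sum\<close>

text \<open>
  The factorised sums involve negative powers of \<open>q\<close> and exponents \<open>e (e - 1) / 2\<close> with negative \<open>e\<close>.
  Real powers accommodate both and keep the arithmetic of exponents free of integer division.
\<close>

lemma powr_choose_2:
  fixes q :: real
  assumes "q > 0"
  shows "q ^ (k choose 2) = q powr (real k * (real k - 1) / 2)"
proof -
  have "real (k choose 2) = real k * (real k - 1) / 2"
    by (induction k) (simp_all add: numeral_2_eq_2 field_simps)
  then show ?thesis
    using assms powr_realpow[of q "k choose 2"] by metis
qed

text \<open>
  For \<open>e = \<bar>k - l\<bar>\<close>, the summands \<open>q^C(e)\<close> and \<open>q^(C(e) + e)\<close> are \<open>q^C(k - l)\<close> and \<open>q^C(l - k)\<close> in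
  one order or the other. The maximum term is \<open>q^(C(k - l) + k)\<close> in either case: for \<open>l > k\<close>,
  \<open>C(k - l) + k = C(e) + e + k = C(e) + l\<close>.
\<close>

lemma \<beta>_q_0_0:
  assumes "q > 0"
  shows "real_of_int (\<beta>_q q k l 0 0) = (- 1) ^ (k + l) *
     (real q powr ((real k - real l) * (real k - real l - 1) / 2)
      + real q powr ((real l - real k) * (real l - real k - 1) / 2)
      - real q powr ((real k - real l) * (real k - real l - 1) / 2 + real k))"
proof -
  have q: "real q > 0" using assms by simp
  define e where "e = nat \<bar>int k - int l\<bar>"
  have *: "real_of_int (\<beta>_q q k l 0 0) = (- 1) ^ (k + l) *
      (real q powr (real e * (real e - 1) / 2) + real q powr (real e * (real e - 1) / 2 + real e)
       - real q powr (real e * (real e - 1) / 2 + real (max k l)))"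
    using q by (simp add: \<beta>_q_def e_def[symmetric] powr_choose_2 powr_add powr_realpow algebra_simps)
  show ?thesis
  proof (cases "l \<le> k")
    case True
    then have k: "real k = real l + real e" and max: "max k l = k" by (simp_all add: e_def)
    show ?thesis
      unfolding * max k by (simp add: field_simps)
  next
    case False
    then have l: "real l = real k + real e" and max: "max k l = l" by (simp_all add: e_def)
    show ?thesis
      unfolding * max l by (simp add: field_simps)
  qed
qed

text \<open>
  The three summands in \<open>\<beta>_q_0_0\<close> all give sums of this form: the first for \<open>s = 0\<close>, the last for
  \<open>s = 1\<close>, and the middle one for \<open>s = 0\<close> with the roles of \<open>A\<close> and \<open>B\<close> exchanged.
\<close>

definition twisted_sum :: "nat \<Rightarrow> real \<Rightarrow> nat \<Rightarrow> nat \<Rightarrow> real" where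
  "twisted_sum q s A B = (\<Sum>k\<le>A. \<Sum>l\<le>B. real_of_int (\<alpha>_q q A B k l) * (- 1) ^ (k + l) *
     real q powr ((real k - real l) * (real k - real l - 1) / 2 + s * real k))"

text \<open>
  The exponent \<open>(A - k) (B - l) + (k - l) (k - l - 1) / 2 + s k\<close> contains no product \<open>k l\<close>: it equals
  \<open>A B + k (k - 1) / 2 + (s - B) k + l (l - 1) / 2 + (1 - A) l\<close>. The \<open>q\<close>-binomial theorem therefore
  applies to each index separately, at \<open>x = q^(s - B)\<close> and at \<open>x = q^(1 - A)\<close>.
\<close>

lemma twisted_sum_eq:
  assumes "q > 0"
  shows "twisted_sum q s A B = real q powr (real A * real B)
     * (\<Prod>i<A. 1 - real q powr (s - real B + real i))
     * (\<Prod>i<B. 1 - real q powr (1 - real A + real i))"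
proof -
  have q: "real q > 0" using assms by simp
  define f where "f n x k = real (q_binomial q n k) * (- 1) ^ k * real q ^ (k choose 2) * (real q powr x) ^ k"
    for n x k
  have f_sum: "(\<Sum>k\<le>n. f n x k) = (\<Prod>i<n. 1 - real q powr (x + real i))" for n x
    using q_binomial_theorem[of q n "real q powr x"] q
    by (simp add: f_def powr_add powr_realpow)
  have factorisation: "real_of_int (\<alpha>_q q A B k l) * (- 1) ^ (k + l) *
     real q powr ((real k - real l) * (real k - real l - 1) / 2 + s * real k)
     = real q powr (real A * real B) * (f A (s - real B) k * f B (1 - real A) l)"
    if "k \<le> A" "l \<le> B" for k l
  proof -
    have e: "real q ^ ((A - k) * (B - l)) = real q powr ((real A - real k) * (real B - real l))"
      using that q by (simp add: powr_realpow[symmetric] of_nat_diff)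
    have p: "(real q powr x) ^ n = real q powr (x * real n)" for x n
      using q by (simp add: powr_realpow[symmetric] powr_powr)
    have "real q powr ((real A - real k) * (real B - real l)) *
        real q powr ((real k - real l) * (real k - real l - 1) / 2 + s * real k)
      = real q powr (real A * real B) * (real q powr (real k * (real k - 1) / 2) *
         real q powr ((s - real B) * real k)) * (real q powr (real l * (real l - 1) / 2) *
         real q powr ((1 - real A) * real l))"
      unfolding powr_add[symmetric] by (rule arg_cong[where f = "\<lambda>x. real q powr x"]) (simp add: field_simps)
    then show ?thesis
      by (simp add: \<alpha>_q_def f_def e p powr_choose_2[OF q] power_add)
  qed
  have "twisted_sum q s A B =
      real q powr (real A * real B) * (\<Sum>k\<le>A. \<Sum>l\<le>B. f A (s - real B) k * f B (1 - real A) l)"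
    by (simp add: twisted_sum_def factorisation sum_distrib_left)
  then show ?thesis
    by (simp add: sum_product[symmetric] f_sum)
qed

text \<open>
  For positive \<open>A\<close> and \<open>B\<close> all three twisted sums vanish. For \<open>A = 0 < B\<close> or \<open>B = 0 < A\<close> one of the two
  with \<open>s = 0\<close> vanishes and the other cancels against the one with \<open>s = 1\<close>. For \<open>A = B = 0\<close> the result is
  \<open>1 + 1 - 1\<close>.
\<close>

lemma \<alpha>_q_\<beta>_q_kernel:
  assumes "q > 0"
  shows "(\<Sum>k\<le>A. \<Sum>l\<le>B. \<alpha>_q q A B k l * \<beta>_q q k l 0 0) = (if A = 0 \<and> B = 0 then 1 else 0)"
proof -
  have q: "real q > 0" using assms by simp
  \<comment> \<open>The factor with index \<open>i = m - j\<close> has exponent \<open>0\<close>.\<close>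
  have vanish: "(\<Prod>i<n. 1 - real q powr (s - real m + real i)) = 0"
    if "s = real j" "j \<le> m" "m - j < n" for n m s j
    using that q by (intro prod_zero bexI[of _ "m - j"]) (auto simp: of_nat_diff)
  have swap: "\<alpha>_q q A B k l = \<alpha>_q q B A l k" for k l
    by (simp add: \<alpha>_q_def mult.commute)
  have "real_of_int (\<Sum>k\<le>A. \<Sum>l\<le>B. \<alpha>_q q A B k l * \<beta>_q q k l 0 0)
      = twisted_sum q 0 A B
        + (\<Sum>k\<le>A. \<Sum>l\<le>B. real_of_int (\<alpha>_q q A B k l) * (- 1) ^ (k + l) *
             real q powr ((real l - real k) * (real l - real k - 1) / 2))
        - twisted_sum q 1 A B"
    unfolding twisted_sum_def of_int_sum of_int_mult \<beta>_q_0_0[OF assms]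
      sum.distrib[symmetric] sum_subtractf[symmetric]
    by (intro sum.cong refl) (simp add: algebra_simps)
  also have "(\<Sum>k\<le>A. \<Sum>l\<le>B. real_of_int (\<alpha>_q q A B k l) * (- 1) ^ (k + l) *
             real q powr ((real l - real k) * (real l - real k - 1) / 2)) = twisted_sum q 0 B A"
    unfolding twisted_sum_def by (subst sum.swap) (simp add: swap add.commute)
  also have "twisted_sum q 0 A B + twisted_sum q 0 B A - twisted_sum q 1 A B
      = (if A = 0 \<and> B = 0 then 1 else 0)"
  proof -
    consider "A = 0" "B = 0" | "A = 0" "B > 0" | "A > 0" "B = 0" | "A > 0" "B > 0" by blast
    then show ?thesis
    proof cases
      case 4
      \<comment> \<open>The exponents \<open>i - n\<close> for \<open>i < m\<close> include \<open>0\<close> if \<open>n < m\<close>, and the exponents \<open>i - (m - 1)\<close> for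
        \<open>i < n\<close> include \<open>0\<close> if \<open>m \<le> n\<close>.\<close>
      have "twisted_sum q 0 m n = 0" if "m > 0" for m n
        using vanish[of 0 0 n m] vanish[of 1 1 m n] that
        by (cases "n < m") (auto simp: twisted_sum_eq[OF assms])
      \<comment> \<open>Here the first product starts at \<open>1 - B\<close> instead, so the two cases overlap at \<open>A = B\<close>.\<close>
      moreover have "twisted_sum q 1 A B = 0"
        using vanish[of 1 1 B A] vanish[of 1 1 A B] 4
        by (cases "B \<le> A") (auto simp: twisted_sum_eq[OF assms])
      ultimately show ?thesis using 4 by simp
    qed (use q vanish[of 0 0 0 A] vanish[of 0 0 0 B] in \<open>simp_all add: twisted_sum_eq[OF assms]\<close>)
  qed
  finally have "real_of_int (\<Sum>k\<le>A. \<Sum>l\<le>B. \<alpha>_q q A B k l * \<beta>_q q k l 0 0)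
      = real_of_int (if A = 0 \<and> B = 0 then 1 else 0)"
    by simp
  then show ?thesis
    by (simp only: of_int_eq_iff)
qed

section \<open>The matrices \<open>\<alpha>\<close> and \<open>\<beta>\<close> are mutually inverse\<close>

lemma \<alpha>_q_eq_0: "a < c \<or> b < d \<Longrightarrow> \<alpha>_q q a b c d = 0"
  by (auto simp: \<alpha>_q_def)

lemma \<beta>_q_eq_0: "a < c \<or> b < d \<Longrightarrow> \<beta>_q q a b c d = 0"
  by (auto simp: \<beta>_q_def)

lemma sum_atMost_shift_support:
  fixes f :: "nat \<Rightarrow> 'a::comm_monoid_add"
  assumes "u \<le> a" "\<And>c. c < u \<Longrightarrow> f c = 0"
  shows "sum f {..a} = (\<Sum>k\<le>a - u. f (u + k))"
proof -
  have "sum f {..a} = sum f {u..a}"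
    using assms by (intro sum.mono_neutral_right) auto
  also have "\<dots> = (\<Sum>k\<le>a - u. f (u + k))"
    using assms(1) by (intro sum.reindex_bij_witness[of _ "\<lambda>k. u + k" "\<lambda>c. c - u"]) auto
  finally show ?thesis .
qed

text \<open>
  Common to both orders of multiplication: triangularity confines the inner indices to \<open>u \<le> c \<le> a\<close> and
  \<open>v \<le> d \<le> b\<close>, and the shift by \<open>u\<close> and \<open>v\<close> then turns the entry into the constant \<open>C\<close> times a kernel
  sum. Only on the diagonal is that sum nonzero, so \<open>C\<close> matters only there.
\<close>

lemma matrix_product_eq_delta:
  fixes f g :: "nat \<Rightarrow> nat \<Rightarrow> nat \<Rightarrow> nat \<Rightarrow> int"
  assumes tri: "\<And>a b c d. a < c \<or> b < d \<Longrightarrow> f a b c d = 0" "\<And>a b c d. a < c \<or> b < d \<Longrightarrow> g a b c d = 0"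
    and prod: "\<And>k l. u \<le> a \<Longrightarrow> v \<le> b \<Longrightarrow> k \<le> a - u \<Longrightarrow> l \<le> b - v \<Longrightarrow>
        f a b (u + k) (v + l) * g (u + k) (v + l) u v = C * h k l"
    and C: "a = u \<Longrightarrow> b = v \<Longrightarrow> C = 1"
    and h: "(\<Sum>k\<le>a - u. \<Sum>l\<le>b - v. h k l) = (if a - u = 0 \<and> b - v = 0 then 1 else 0)"
  shows "(\<Sum>c\<le>a. \<Sum>d\<le>b. f a b c d * g c d u v) = (if a = u \<and> b = v then 1 else 0)"
proof (cases "u \<le> a \<and> v \<le> b")
  case True
  have "(\<Sum>c\<le>a. \<Sum>d\<le>b. f a b c d * g c d u v)
      = (\<Sum>k\<le>a - u. \<Sum>d\<le>b. f a b (u + k) d * g (u + k) d u v)"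
    using True by (intro sum_atMost_shift_support) (simp_all add: tri)
  also have "\<dots> = (\<Sum>k\<le>a - u. \<Sum>l\<le>b - v. f a b (u + k) (v + l) * g (u + k) (v + l) u v)"
    using True by (intro sum.cong refl sum_atMost_shift_support) (simp_all add: tri)
  also have "\<dots> = C * (\<Sum>k\<le>a - u. \<Sum>l\<le>b - v. h k l)"
    using True by (simp add: prod sum_distrib_left)
  finally show ?thesis
    unfolding h using True C by auto
next
  case False
  then have zero: "f a b c d * g c d u v = 0" for c d
    using tri by (metis le_less_trans mult_eq_0_iff not_le)
  show ?thesis
    unfolding zero using False by auto
qed

lemma \<alpha>_q_\<beta>_q_shift:
  assumes "u \<le> a" "v \<le> b" "k \<le> a - u" "l \<le> b - v"
  shows "\<alpha>_q q a b (u + k) (v + l) * \<beta>_q q (u + k) (v + l) u v =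
    int (q_binomial q a u * q_binomial q b v) * (\<alpha>_q q (a - u) (b - v) k l * \<beta>_q q k l 0 0)"
proof -
  define w where "w = int q ^ ((a - u - k) * (b - v - l)) * \<beta>_q q k l 0 0"
  have "\<alpha>_q q a b (u + k) (v + l) * \<beta>_q q (u + k) (v + l) u v =
      int (q_binomial q a (u + k) * q_binomial q (u + k) u) *
      int (q_binomial q b (v + l) * q_binomial q (v + l) v) * w"
    by (simp add: \<alpha>_q_def \<beta>_q_def w_def Let_def)
  also have "\<dots> = int (q_binomial q a u * q_binomial q (a - u) k) *
      int (q_binomial q b v * q_binomial q (b - v) l) * w"
    using assms by (simp only: q_binomial_trinomial_revision)
  finally show ?thesis
    by (simp add: \<alpha>_q_def w_def mult_ac)
qed

text \<open>
  In the opposite order it is \<open>\<beta>\<close> that contains the differences \<open>a - u - k\<close> and \<open>b - v - l\<close>, whereas the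
  power of \<open>q\<close> in \<open>\<alpha>\<close> has exponent \<open>k l\<close>. Symmetry of the \<open>q\<close>-binomial coefficients makes this the
  reflected kernel.
\<close>

lemma \<beta>_q_\<alpha>_q_shift:
  assumes "u \<le> a" "v \<le> b" "k \<le> a - u" "l \<le> b - v"
  shows "\<beta>_q q a b (u + k) (v + l) * \<alpha>_q q (u + k) (v + l) u v =
    int (q_binomial q a u * q_binomial q b v) *
      (\<alpha>_q q (a - u) (b - v) (a - u - k) (b - v - l) * \<beta>_q q (a - u - k) (b - v - l) 0 0)"
proof -
  define w where "w = int q ^ (k * l) * \<beta>_q q (a - u - k) (b - v - l) 0 0"
  have "\<beta>_q q a b (u + k) (v + l) * \<alpha>_q q (u + k) (v + l) u v =
      int (q_binomial q a (u + k) * q_binomial q (u + k) u) *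
      int (q_binomial q b (v + l) * q_binomial q (v + l) v) * w"
    by (simp add: \<alpha>_q_def \<beta>_q_def w_def Let_def)
  also have "\<dots> = int (q_binomial q a u * q_binomial q (a - u) k) *
      int (q_binomial q b v * q_binomial q (b - v) l) * w"
    using assms by (simp only: q_binomial_trinomial_revision)
  finally show ?thesis
    using assms q_binomial_symmetric[OF assms(3), of q] q_binomial_symmetric[OF assms(4), of q]
    by (simp add: \<alpha>_q_def w_def mult_ac)
qed

lemma \<alpha>_q_\<beta>_q_inverse:
  assumes "q > 0"
  shows "(\<Sum>c\<le>a. \<Sum>d\<le>b. \<alpha>_q q a b c d * \<beta>_q q c d u v) = (if a = u \<and> b = v then 1 else 0)"
  by (rule matrix_product_eq_delta[where f = "\<alpha>_q q" and g = "\<beta>_q q"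
          and C = "int (q_binomial q a u * q_binomial q b v)"
          and h = "\<lambda>k l. \<alpha>_q q (a - u) (b - v) k l * \<beta>_q q k l 0 0",
        OF \<alpha>_q_eq_0 \<beta>_q_eq_0 \<alpha>_q_\<beta>_q_shift _ \<alpha>_q_\<beta>_q_kernel[OF assms]]) auto

lemma \<beta>_q_\<alpha>_q_inverse:
  assumes "q > 0"
  shows "(\<Sum>c\<le>a. \<Sum>d\<le>b. \<beta>_q q a b c d * \<alpha>_q q c d u v) = (if a = u \<and> b = v then 1 else 0)"
proof (rule matrix_product_eq_delta[where f = "\<beta>_q q" and g = "\<alpha>_q q"
          and C = "int (q_binomial q a u * q_binomial q b v)"
          and h = "\<lambda>k l. \<alpha>_q q (a - u) (b - v) (a - u - k) (b - v - l) * \<beta>_q q (a - u - k) (b - v - l) 0 0",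
        OF \<beta>_q_eq_0 \<alpha>_q_eq_0 \<beta>_q_\<alpha>_q_shift])
  have reflect: "(\<Sum>k\<le>n. g (n - k)) = (\<Sum>k\<le>n. g k)" for n and g :: "nat \<Rightarrow> int"
    by (rule sum.reindex_bij_witness[of _ "\<lambda>k. n - k" "\<lambda>k. n - k"]) auto
  show "(\<Sum>k\<le>a - u. \<Sum>l\<le>b - v.
      \<alpha>_q q (a - u) (b - v) (a - u - k) (b - v - l) * \<beta>_q q (a - u - k) (b - v - l) 0 0)
      = (if a - u = 0 \<and> b - v = 0 then 1 else 0)"
    unfolding \<alpha>_q_\<beta>_q_kernel[OF assms, symmetric]
    by (subst reflect[of "\<lambda>k. \<Sum>l\<le>b - v. \<alpha>_q q (a - u) (b - v) k (b - v - l) * \<beta>_q q k (b - v - l) 0 0"])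
       (intro sum.cong refl reflect)
qed auto

section \<open>The action on polynomials\<close>

lemma smult_sum_right: "smult c (\<Sum>i\<in>I. p i) = (\<Sum>i\<in>I. smult c (p i))"
  by (induction I rule: infinite_finite_induct) (simp_all add: smult_add_right)

lemma xy_monom_sum: "(\<Sum>i\<in>I. xy_monom (f i) a b) = xy_monom (\<Sum>i\<in>I. f i) a b"
  by (simp add: xy_monom_def monom_sum)

text \<open>
  A rectangular range of exponents, independent of the row \<open>i\<close>, lets the sums that arise from iterating
  \<open>\<star>\<close> be interchanged freely.
\<close>

lemma poly_eq_sum_xy_monom:
  obtains p s t where "P = (\<Sum>i\<le>s. \<Sum>j\<le>t. xy_monom (p i j) i j)"
proof -
  define t where "t = (\<Sum>i\<le>degree P. degree (coeff P i))"
  have "degree (coeff P i) \<le> t" for i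
    by (cases "i \<le> degree P") (auto simp: t_def coeff_eq_0 intro: member_le_sum)
  then have "coeff P i = (\<Sum>j\<le>t. monom (coeff (coeff P i) j) j)" for i
    by (simp add: poly_as_sum_of_monoms')
  then have "P = (\<Sum>i\<le>degree P. \<Sum>j\<le>t. xy_monom (coeff (coeff P i) j) i j)"
    by (simp add: xy_monom_def monom_sum[symmetric] poly_as_sum_of_monoms)
  then show ?thesis by (rule that)
qed

text \<open>
  For a triangular \<open>\<gamma>\<close> the inner sums may run over the whole rectangle, which exhibits \<open>\<star>\<close> as the product
  of the coefficient vector of the polynomial with the matrix \<open>\<gamma>\<close>.
\<close>

lemma star_triangular:
  assumes tri: "\<And>i j a b. i < a \<or> j < b \<Longrightarrow> \<gamma> i j a b = 0"
  shows "\<gamma> \<star> (\<Sum>i\<le>s. \<Sum>j\<le>t. xy_monom (p i j) i j) =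
     (\<Sum>a\<le>s. \<Sum>b\<le>t. xy_monom (\<Sum>i\<le>s. \<Sum>j\<le>t. p i j * \<gamma> i j a b) a b)"
proof -
  have "smult [:p i j:] (\<Sum>a\<le>i. \<Sum>b\<le>j. xy_monom (\<gamma> i j a b) a b) =
      (\<Sum>a\<le>s. \<Sum>b\<le>t. xy_monom (p i j * \<gamma> i j a b) a b)" if "i \<le> s" "j \<le> t" for i j
  proof -
    have "smult [:p i j:] (\<Sum>a\<le>i. \<Sum>b\<le>j. xy_monom (\<gamma> i j a b) a b) =
        (\<Sum>a\<le>i. \<Sum>b\<le>j. xy_monom (p i j * \<gamma> i j a b) a b)"
      by (simp add: smult_sum_right xy_monom_def smult_monom)
    also have "\<dots> = (\<Sum>a\<le>i. \<Sum>b\<le>t. xy_monom (p i j * \<gamma> i j a b) a b)"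
      using that by (intro sum.cong refl sum.mono_neutral_left) (auto simp: tri xy_monom_def)
    also have "\<dots> = (\<Sum>a\<le>s. \<Sum>b\<le>t. xy_monom (p i j * \<gamma> i j a b) a b)"
      using that by (intro sum.mono_neutral_left) (auto simp: tri xy_monom_def)
    finally show ?thesis .
  qed
  then have "\<gamma> \<star> (\<Sum>i\<le>s. \<Sum>j\<le>t. xy_monom (p i j) i j) =
      (\<Sum>i\<le>s. \<Sum>j\<le>t. \<Sum>a\<le>s. \<Sum>b\<le>t. xy_monom (p i j * \<gamma> i j a b) a b)"
    by (simp add: star_sum_xy_monom[OF refl])
  also have "\<dots> = (\<Sum>i\<le>s. \<Sum>a\<le>s. \<Sum>j\<le>t. \<Sum>b\<le>t. xy_monom (p i j * \<gamma> i j a b) a b)"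
    by (intro sum.cong refl sum.swap)
  also have "\<dots> = (\<Sum>a\<le>s. \<Sum>i\<le>s. \<Sum>b\<le>t. \<Sum>j\<le>t. xy_monom (p i j * \<gamma> i j a b) a b)"
    by (subst sum.swap) (intro sum.cong refl sum.swap)
  also have "\<dots> = (\<Sum>a\<le>s. \<Sum>b\<le>t. \<Sum>i\<le>s. \<Sum>j\<le>t. xy_monom (p i j * \<gamma> i j a b) a b)"
    by (intro sum.cong refl sum.swap)
  finally show ?thesis
    by (simp add: xy_monom_sum)
qed

text \<open>
  As \<open>\<star>\<close> acts on row vectors, with the matrix on their right, applying \<open>\<gamma>\<close> first and \<open>\<gamma>'\<close> second amounts to the matrix
  product \<open>\<gamma> \<gamma>'\<close>, with \<open>\<gamma>\<close> on the left.
\<close>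

lemma star_star_inverse:
  assumes tri: "\<And>i j a b. i < a \<or> j < b \<Longrightarrow> \<gamma> i j a b = 0"
      "\<And>i j a b. i < a \<or> j < b \<Longrightarrow> \<gamma>' i j a b = 0"
    and inverse: "\<And>i j c d. (\<Sum>a\<le>i. \<Sum>b\<le>j. \<gamma> i j a b * \<gamma>' a b c d) = (if i = c \<and> j = d then 1 else 0)"
  shows "\<gamma>' \<star> (\<gamma> \<star> P) = P"
proof -
  obtain p s t where P: "P = (\<Sum>i\<le>s. \<Sum>j\<le>t. xy_monom (p i j) i j)"
    by (rule poly_eq_sum_xy_monom)
  have support: "a \<le> i \<and> b \<le> j" if "\<gamma> i j a b \<noteq> 0" for i j a b
    using tri(1) that not_le by blast
  have "(\<Sum>a\<le>s. \<Sum>b\<le>t. (\<Sum>i\<le>s. \<Sum>j\<le>t. p i j * \<gamma> i j a b) * \<gamma>' a b c d) = p c d"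
    if cd: "c \<le> s" "d \<le> t" for c d
  proof -
    have "(\<Sum>a\<le>s. \<Sum>b\<le>t. (\<Sum>i\<le>s. \<Sum>j\<le>t. p i j * \<gamma> i j a b) * \<gamma>' a b c d)
        = (\<Sum>(a, b)\<in>{..s} \<times> {..t}. \<Sum>(i, j)\<in>{..s} \<times> {..t}. p i j * (\<gamma> i j a b * \<gamma>' a b c d))"
      by (simp add: sum.cartesian_product[symmetric] sum_distrib_right mult.assoc)
    also have "\<dots> = (\<Sum>(i, j)\<in>{..s} \<times> {..t}. \<Sum>(a, b)\<in>{..s} \<times> {..t}. p i j * (\<gamma> i j a b * \<gamma>' a b c d))"
      unfolding case_prod_unfold by (rule sum.swap)
    also have "\<dots> = (\<Sum>(i, j)\<in>{..s} \<times> {..t}. p i j * (\<Sum>(a, b)\<in>{..i} \<times> {..j}. \<gamma> i j a b * \<gamma>' a b c d))"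
      unfolding case_prod_unfold sum_distrib_left
      by (rule sum.cong[OF refl], rule sum.mono_neutral_right) (auto dest: support)
    also have "\<dots> = (\<Sum>x\<in>{..s} \<times> {..t}. if x = (c, d) then p c d else 0)"
      by (intro sum.cong refl) (auto simp: sum.cartesian_product[symmetric] inverse split: if_splits)
    also have "\<dots> = p c d"
      using cd by simp
    finally show ?thesis .
  qed
  then show ?thesis
    unfolding P
    by (simp add: star_triangular[of \<gamma>, OF tri(1)] star_triangular[of \<gamma>', OF tri(2)] cong: sum.cong_simp)
qed

theorem corollary62:
  fixes q a b u v :: nat
  assumes "primepow q \<or> q = 1"
  shows "(\<Sum>c=0..a. \<Sum>d=0..b. \<alpha>_q q a b c d * \<beta>_q q c d u v) =
           (if a = u then 1 else 0) * (if b = v then 1 else 0) \<and>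
         (\<forall>P :: int poly poly.
           \<alpha>_q q \<star> (\<beta>_q q \<star> P) = P \<and> P = \<beta>_q q \<star> (\<alpha>_q q \<star> P))"
proof -
  have q: "q > 0"
    using assms primepow_gt_0_nat by auto
  show ?thesis
    using \<alpha>_q_\<beta>_q_inverse[OF q, of a b u v]
      star_star_inverse[OF \<beta>_q_eq_0 \<alpha>_q_eq_0 \<beta>_q_\<alpha>_q_inverse[OF q]]
      star_star_inverse[OF \<alpha>_q_eq_0 \<beta>_q_eq_0 \<alpha>_q_\<beta>_q_inverse[OF q]]
    by (auto simp: atMost_atLeast0)
qed

end
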